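(* Let $d$ be a positive integer and let $V$ be a translation-dilation invariant linear subspace of the polynomial ring $\mathbb{R}[x]=\mathbb{R}[x_1,\dots,x_d]$. If $(p_n)_{n\in\mathbb{N}}$ is a sequence of elements of $V$ which converges pointwise on $\mathbb{R}^d$ to a polynomial $p\in\mathbb{R}[x]$, then $p\in V$.
   Context: Polynomials in $\mathbb{R}[x_1,\dots,x_d]$ are identified with the real polynomial functions on $\mathbb{R}^d$. For $a,x\in\mathbb{R}^d$ let $a\cdot x=(a_1x_1,a_2x_2,\dots,a_dx_d)$ (componentwise product). For $f:\mathbb{R}^d\to\mathbb{R}$ and $y\in\mathbb{R}^d$ let $\tau_yf(x)=f(x+y)$ (translate of $f$ by $y$) and $\sigma_yf(x)=f(x\cdot y)$ (dilate of $f$ by $y$). A set $H$ of real functions on $\mathbb{R}^d$ is translation invariant if $\tau_yf\in H$ for all $f\in H$ and all $y\in\mathbb{R}^d$; it is dilation invariant if $\sigma_yf\in H$ for all $f\in H$ and all $y\in\mathbb{R}^d$; it is translation-dilation invariant (TDI) if it is both. *)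

theory Defs
  imports "HOL-Analysis.Analysis" "HOL-Library.Function_Algebras"
begin

text \<open>
  Function types carry no instance of class \<open>real_vector\<close>, so real linear subspaces of
  function spaces are obtained from the locale \<open>vector_space\<close>; addition and zero of functions
  are those of \<open>HOL-Library.Function_Algebras\<close>.
\<close>

definition fun_scale :: "real \<Rightarrow> ('a \<Rightarrow> real) \<Rightarrow> ('a \<Rightarrow> real)" where
  "fun_scale c f = (\<lambda>x. c * f x)"

global_interpretation real_fun: vector_space "fun_scale :: real \<Rightarrow> ('a \<Rightarrow> real) \<Rightarrow> ('a \<Rightarrow> real)"
  by unfold_locales (auto simp: fun_scale_def fun_eq_iff algebra_simps)

definition translate :: "real ^ 'n \<Rightarrow> (real ^ 'n \<Rightarrow> real) \<Rightarrow> (real ^ 'n \<Rightarrow> real)" where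
  "translate y f = (\<lambda>x. f (x + y))"

text \<open>Multiplication on \<^typ>\<open>real ^ 'n\<close> is componentwise.\<close>

definition dilate :: "real ^ 'n \<Rightarrow> (real ^ 'n \<Rightarrow> real) \<Rightarrow> (real ^ 'n \<Rightarrow> real)" where
  "dilate y f = (\<lambda>x. f (x * y))"

definition translation_invariant :: "(real ^ 'n \<Rightarrow> real) set \<Rightarrow> bool" where
  "translation_invariant H \<longleftrightarrow> (\<forall>f\<in>H. \<forall>y. translate y f \<in> H)"

definition dilation_invariant :: "(real ^ 'n \<Rightarrow> real) set \<Rightarrow> bool" where
  "dilation_invariant H \<longleftrightarrow> (\<forall>f\<in>H. \<forall>y. dilate y f \<in> H)"

definition TDI :: "(real ^ 'n \<Rightarrow> real) set \<Rightarrow> bool" where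
  "TDI H \<longleftrightarrow> translation_invariant H \<and> dilation_invariant H"

end

theory Submission
  imports Defs
begin

text \<open>
  Dilations separate the monomials of a polynomial, so \<open>V\<close> contains every monomial that occurs
  in one of its elements; translations show that the exponents of the monomials in \<open>V\<close> form a
  down-closed set. If \<open>\<beta>\<close> is not such an exponent, then no \<open>f \<in> V\<close> has a monomial with exponent
  \<open>\<ge> \<beta>\<close>, so the mixed finite difference of order \<open>\<beta>\<close> vanishes on \<open>V\<close>. It is a finite combination
  of point evaluations, hence it also vanishes at the pointwise limit \<open>q\<close>. For \<open>\<beta>\<close> of
  maximal degree among the exponents of \<open>q\<close> with monomial outside \<open>V\<close> this contradicts the
  fact that the difference only sees the nonzero coefficient of \<open>q\<close> at \<open>\<beta>\<close>.
\<close>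

section \<open>Monomials and the expansion of polynomial functions\<close>

definition monomial :: "('n \<Rightarrow> nat) \<Rightarrow> real ^ 'n \<Rightarrow> real" where
  "monomial \<alpha> x = (\<Prod>i\<in>UNIV. (x $ i) ^ \<alpha> i)"

lemma monomial_mult: "monomial \<alpha> x * monomial \<beta> x = monomial (\<lambda>i. \<alpha> i + \<beta> i) x"
  by (simp add: monomial_def power_add prod.distrib)

lemma monomial_mult_arg: "monomial \<alpha> (x * y) = monomial \<alpha> x * monomial \<alpha> y"
  by (simp add: monomial_def power_mult_distrib prod.distrib)

text \<open>Where the exponents differ, a coordinate 2 tells them apart, since powers of 2 are
  injective in the exponent; coordinates 1 silence all other variables. Such a \<open>y\<close>
  later gives a dilation with different eigenvalues on the two monomials.\<close>

lemma monomial_separates: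
  assumes "\<alpha> \<noteq> \<beta>"
  obtains y where "monomial \<alpha> y \<noteq> monomial \<beta> y"
proof -
  obtain i where i: "\<alpha> i \<noteq> \<beta> i" using assms by auto
  define y :: "real ^ 'a" where "y = (\<chi> j. if j = i then 2 else 1)"
  have "monomial \<gamma> y = 2 ^ \<gamma> i" for \<gamma>
  proof -
    have "monomial \<gamma> y = (\<Prod>j\<in>UNIV. if j = i then 2 ^ \<gamma> j else 1)"
      unfolding monomial_def y_def by (intro prod.cong) auto
    then show ?thesis by simp
  qed
  with i show ?thesis by (intro that[of y]) simp
qed

lemma sum_fun_apply: "(\<Sum>i\<in>S. f i) x = (\<Sum>i\<in>S. f i x)"
  by (induction S rule: infinite_finite_induct) auto

text \<open>The product is bilinear, and a product of two monomials is again a monomial. Span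
  induction is applied to one factor at a time, first with the other factor fixed as a
  monomial.\<close>

lemma monomial_span_mult:
  assumes "f \<in> real_fun.span (range monomial)" "g \<in> real_fun.span (range monomial)"
  shows "(\<lambda>x. f x * g x) \<in> real_fun.span (range monomial)"
proof -
  have mono: "(\<lambda>x. monomial \<alpha> x * g x) \<in> real_fun.span (range monomial)" for \<alpha>
    using assms(2)
  proof (induction rule: real_fun.span_induct_alt)
    case base
    then show ?case using real_fun.span_zero by (simp add: zero_fun_def)
  next
    case (step c h g)
    then obtain \<beta> where "h = monomial \<beta>" by auto
    have "(\<lambda>x. monomial \<alpha> x * (fun_scale c h + g) x) =
        fun_scale c (monomial (\<lambda>i. \<alpha> i + \<beta> i)) + (\<lambda>x. monomial \<alpha> x * g x)"
      using \<open>h = monomial \<beta>\<close>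
      by (auto simp: fun_eq_iff fun_scale_def algebra_simps simp flip: monomial_mult)
    moreover have "\<dots> \<in> real_fun.span (range monomial)"
      by (intro real_fun.span_add real_fun.span_scale real_fun.span_base rangeI step)
    ultimately show ?case by simp
  qed
  show ?thesis
    using assms(1)
  proof (induction rule: real_fun.span_induct_alt)
    case base
    then show ?case using real_fun.span_zero by (simp add: zero_fun_def)
  next
    case (step c h f)
    then have "(\<lambda>x. (fun_scale c h + f) x * g x) =
        fun_scale c (\<lambda>x. h x * g x) + (\<lambda>x. f x * g x)"
      by (auto simp: fun_eq_iff fun_scale_def algebra_simps)
    moreover obtain \<alpha> where "h = monomial \<alpha>" using step.hyps by auto
    ultimately show ?case
      using step.IH mono by (simp only:) (intro real_fun.span_add real_fun.span_scale)
  qed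
qed

lemma real_polynomial_function_in_monomial_span:
  fixes f :: "real ^ 'n \<Rightarrow> real"
  assumes "real_polynomial_function f"
  shows "f \<in> real_fun.span (range monomial)"
  using assms
proof (induction rule: real_polynomial_function.induct)
  case (linear f)
  then interpret bounded_linear f .
  have coord: "(\<lambda>x. x $ i) = monomial (\<lambda>j. if j = i then 1 else 0)" for i :: 'n
  proof
    fix x :: "real ^ 'n"
    have "monomial (\<lambda>j. if j = i then 1 else 0) x = (\<Prod>j\<in>UNIV. if j = i then x $ j else 1)"
      unfolding monomial_def by (intro prod.cong) auto
    then show "x $ i = monomial (\<lambda>j. if j = i then 1 else 0) x" by simp
  qed
  have "f = (\<Sum>i\<in>UNIV. fun_scale (f (axis i 1)) (\<lambda>x. x $ i))"
  proof
    fix x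
    have "f x = f (\<Sum>i\<in>UNIV. (x $ i) *\<^sub>R axis i 1)"
      by (simp add: basis_expansion[of x, unfolded scalar_mult_eq_scaleR])
    also have "\<dots> = (\<Sum>i\<in>UNIV. x $ i * f (axis i 1))"
      by (simp add: sum scaleR)
    also have "\<dots> = (\<Sum>i\<in>UNIV. fun_scale (f (axis i 1)) (\<lambda>x. x $ i)) x"
      by (simp add: sum_fun_apply fun_scale_def mult.commute)
    finally show "f x = (\<Sum>i\<in>UNIV. fun_scale (f (axis i 1)) (\<lambda>x. x $ i)) x" .
  qed
  moreover have "\<dots> \<in> real_fun.span (range monomial)"
    unfolding coord by (intro real_fun.span_sum real_fun.span_scale real_fun.span_base) auto
  ultimately show ?case by simp
next
  case (const c)
  have "(\<lambda>x::real ^ 'n. c) = fun_scale c (monomial (\<lambda>i. 0))"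
    by (simp add: fun_eq_iff fun_scale_def monomial_def)
  moreover have "\<dots> \<in> real_fun.span (range monomial)"
    by (intro real_fun.span_scale real_fun.span_base rangeI)
  ultimately show ?case by simp
next
  case (add f g)
  then show ?case using real_fun.span_add[of f _ g] by (simp add: plus_fun_def)
next
  case (mult f g)
  then show ?case by (intro monomial_span_mult)
qed

text \<open>Span membership is unfolded into an explicit finite sum, from which the zero terms are
  then dropped. Nonzero coefficients are what lets dilations extract every monomial of
  \<open>S\<close>.\<close>

lemma monomial_expansion:
  fixes f :: "real ^ 'n \<Rightarrow> real"
  assumes "real_polynomial_function f"
  obtains S c where "finite S" "\<And>\<alpha>. \<alpha> \<in> S \<Longrightarrow> c \<alpha> \<noteq> 0"
    "f = (\<lambda>x. \<Sum>\<alpha>\<in>S. c \<alpha> * monomial \<alpha> x)"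
proof -
  have "\<exists>S c. finite S \<and> f = (\<lambda>x. \<Sum>\<alpha>\<in>S. c \<alpha> * monomial \<alpha> x)"
    using real_polynomial_function_in_monomial_span[OF assms]
  proof (induction rule: real_fun.span_induct_alt)
    case base
    show ?case by (intro exI[of _ "{}"]) (simp add: zero_fun_def)
  next
    case (step a h f)
    obtain \<beta> where h: "h = monomial \<beta>" using step by auto
    obtain S c where S: "finite S" "f = (\<lambda>x. \<Sum>\<alpha>\<in>S. c \<alpha> * monomial \<alpha> x)"
      using step by blast
    \<comment> \<open>The default 0 outside \<open>S\<close> covers both cases: \<beta> may be a new
      exponent or already lie in \<open>S\<close>.\<close>
    define c' where "c' \<alpha> = (if \<alpha> \<in> S then c \<alpha> else 0) + (if \<alpha> = \<beta> then a else 0)" for \<alpha>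
    have "(fun_scale a h + f) x = (\<Sum>\<alpha>\<in>insert \<beta> S. c' \<alpha> * monomial \<alpha> x)" for x
    proof -
      have "(\<Sum>\<alpha>\<in>insert \<beta> S. c' \<alpha> * monomial \<alpha> x) =
          (\<Sum>\<alpha>\<in>insert \<beta> S. (if \<alpha> \<in> S then c \<alpha> else 0) * monomial \<alpha> x) +
          (\<Sum>\<alpha>\<in>insert \<beta> S. if \<alpha> = \<beta> then a * monomial \<alpha> x else 0)"
        unfolding sum.distrib[symmetric] by (intro sum.cong) (auto simp: c'_def algebra_simps)
      also have "(\<Sum>\<alpha>\<in>insert \<beta> S. (if \<alpha> \<in> S then c \<alpha> else 0) * monomial \<alpha> x) =
          (\<Sum>\<alpha>\<in>S. c \<alpha> * monomial \<alpha> x)"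
        using S(1) by (intro sum.mono_neutral_cong_right) auto
      finally show ?thesis using S by (simp add: h fun_scale_def)
    qed
    then show ?case using S(1) by (intro exI[of _ "insert \<beta> S"] exI[of _ c']) auto
  qed
  then obtain S c where S: "finite S" "f = (\<lambda>x. \<Sum>\<alpha>\<in>S. c \<alpha> * monomial \<alpha> x)" by blast
  show thesis
  proof (rule that[of "{\<alpha>\<in>S. c \<alpha> \<noteq> 0}" c])
    show "f = (\<lambda>x. \<Sum>\<alpha>\<in>{\<alpha>\<in>S. c \<alpha> \<noteq> 0}. c \<alpha> * monomial \<alpha> x)"
      unfolding S(2) using S(1) by (intro ext sum.mono_neutral_right) auto
  qed (use S(1) in auto)
qed

section \<open>Monomials in invariant subspaces\<close>

lemma real_fun_subspace_combination:
  assumes "real_fun.subspace V" "\<And>i. i \<in> S \<Longrightarrow> f i \<in> V"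
  shows "(\<lambda>x. \<Sum>i\<in>S. c i * f i x) \<in> V"
proof -
  have "(\<Sum>i\<in>S. fun_scale (c i) (f i)) \<in> V"
    using assms by (intro real_fun.subspace_sum real_fun.subspace_scale)
  also have "(\<Sum>i\<in>S. fun_scale (c i) (f i)) = (\<lambda>x. \<Sum>i\<in>S. c i * f i x)"
    by (simp add: fun_eq_iff sum_fun_apply fun_scale_def)
  finally show ?thesis .
qed

text \<open>Every monomial is an eigenvector of \<open>dilate y\<close>, with eigenvalue its own
  value at \<open>y\<close>. The terms other than \<alpha> can therefore be eliminated one after
  another, as eigenvectors for different eigenvalues.\<close>

lemma dilation_invariant_monomial:
  assumes V: "real_fun.subspace V" "dilation_invariant V"
    and "finite S" "\<alpha> \<in> S" "c \<alpha> \<noteq> 0" "(\<lambda>x. \<Sum>\<gamma>\<in>S. c \<gamma> * monomial \<gamma> x) \<in> V"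
  shows "monomial \<alpha> \<in> V"
proof -
  \<comment> \<open>Each elimination changes the coefficients, so \<open>c\<close> is generalised;
    only the one at \<alpha> has to stay nonzero.\<close>
  have "monomial \<alpha> \<in> V"
    if "finite T" "\<alpha> \<notin> T" "c \<alpha> \<noteq> 0" "(\<lambda>x. \<Sum>\<gamma>\<in>insert \<alpha> T. c \<gamma> * monomial \<gamma> x) \<in> V" for T c
    using that
  proof (induction T arbitrary: c rule: finite_induct)
    case empty
    from real_fun.subspace_scale[OF V(1) empty(3), of "inverse (c \<alpha>)"] empty(2)
    show ?case by (simp add: fun_scale_def mult.assoc[symmetric])
  next
    case (insert \<beta> T)
    obtain y where y: "monomial \<alpha> y \<noteq> monomial \<beta> y"
      using insert.prems(1) by (auto intro: monomial_separates[of \<alpha> \<beta>])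
    define f where "f = (\<lambda>x. \<Sum>\<gamma>\<in>insert \<alpha> (insert \<beta> T). c \<gamma> * monomial \<gamma> x)"
    define d where "d \<gamma> = c \<gamma> * (monomial \<gamma> y - monomial \<beta> y)" for \<gamma>
    \<comment> \<open>This combination multiplies the coefficient at \<gamma> by
      \<open>monomial \<gamma> y - monomial \<beta> y\<close>, which is zero at \<beta> and nonzero
      at \<alpha>.\<close>
    have "dilate y f - fun_scale (monomial \<beta> y) f \<in> V"
      using V insert.prems(3) unfolding f_def[symmetric]
      by (auto simp: dilation_invariant_def intro!: real_fun.subspace_diff real_fun.subspace_scale)
    also have "dilate y f - fun_scale (monomial \<beta> y) f =
        (\<lambda>x. \<Sum>\<gamma>\<in>insert \<alpha> (insert \<beta> T). d \<gamma> * monomial \<gamma> x)"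
      unfolding fun_eq_iff dilate_def fun_scale_def f_def d_def minus_apply monomial_mult_arg
        sum_distrib_left sum_subtractf[symmetric]
      by (intro allI sum.cong) (auto simp: algebra_simps)
    also have "\<dots> = (\<lambda>x. \<Sum>\<gamma>\<in>insert \<alpha> T. d \<gamma> * monomial \<gamma> x)"
      using insert.hyps by (intro ext sum.mono_neutral_right) (auto simp: d_def)
    finally show ?case
      using insert.prems y by (intro insert.IH[of d]) (auto simp: d_def)
  qed
  from this[of "S - {\<alpha>}" c] assms show ?thesis by (simp add: insert_absorb)
qed

text \<open>By the binomial theorem in each variable, translation by the all-ones vector turns
  \<open>monomial \<alpha>\<close> into a sum over all exponents below \<alpha> with positive
  coefficients; dilations then isolate the term at \<beta>.\<close>

lemma TDI_monomial_mono:
  fixes V :: "(real ^ 'n \<Rightarrow> real) set"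
  assumes "real_fun.subspace V" "TDI V" "monomial \<alpha> \<in> V" "\<And>i. \<beta> i \<le> \<alpha> i"
  shows "monomial \<beta> \<in> V"
proof -
  define S where "S = PiE UNIV (\<lambda>i. {..\<alpha> i})"
  define c where "c \<gamma> = (\<Prod>i\<in>UNIV. real (\<alpha> i choose \<gamma> i))" for \<gamma>
  have "translate 1 (monomial \<alpha>) = (\<lambda>x. \<Sum>\<gamma>\<in>S. c \<gamma> * monomial \<gamma> x)"
  proof
    fix x :: "real ^ 'n"
    have "translate 1 (monomial \<alpha>) x =
        (\<Prod>i\<in>UNIV. \<Sum>k\<in>{..\<alpha> i}. real (\<alpha> i choose k) * (x $ i) ^ k)"
      by (simp add: translate_def monomial_def binomial_ring)
    also have "\<dots> = (\<Sum>\<gamma>\<in>S. \<Prod>i\<in>UNIV. real (\<alpha> i choose \<gamma> i) * (x $ i) ^ \<gamma> i)"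
      unfolding S_def by (rule prod_sum_PiE) auto
    finally show "translate 1 (monomial \<alpha>) x = (\<Sum>\<gamma>\<in>S. c \<gamma> * monomial \<gamma> x)"
      by (simp add: c_def monomial_def prod.distrib)
  qed
  moreover have "translate 1 (monomial \<alpha>) \<in> V"
    using assms by (auto simp: TDI_def translation_invariant_def)
  moreover have "finite S" "\<beta> \<in> S" "c \<beta> \<noteq> 0"
    using assms(4) by (auto simp: S_def c_def not_less intro!: finite_PiE)
  ultimately show ?thesis
    using assms by (intro dilation_invariant_monomial[of V S \<beta> c]) (auto simp: TDI_def)
qed

section \<open>Finite differences that annihilate low powers\<close>

text \<open>These are weights of a difference of order \<open>b\<close> at the nodes 0 to
  \<open>b\<close>. Each induction step composes with one more forward difference, which lowers the
  degree of a polynomial by one.\<close>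

lemma finite_difference_weights:
  "\<exists>w :: nat \<Rightarrow> real. (\<forall>a<b. (\<Sum>k\<le>b. w k * real k ^ a) = 0) \<and> (\<Sum>k\<le>b. w k * real k ^ b) \<noteq> 0"
proof (induction b)
  case 0
  show ?case by (intro exI[of _ "\<lambda>_. 1"]) simp
next
  case (Suc b)
  then obtain w :: "nat \<Rightarrow> real" where
    w: "\<And>a. a < b \<Longrightarrow> (\<Sum>k\<le>b. w k * real k ^ a) = 0" "(\<Sum>k\<le>b. w k * real k ^ b) \<noteq> 0"
    by blast
  \<comment> \<open>Summing g against \<open>w'\<close> amounts to summing g(k + 1) - g(k) against
    \<open>w\<close>.\<close>
  define w' where
    "w' k = (case k of 0 \<Rightarrow> 0 | Suc j \<Rightarrow> w j) - (if k \<le> b then w k else 0)" for k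
  have "(\<Sum>k\<le>Suc b. w' k * real k ^ a) =
      (\<Sum>j<a. real (a choose j) * (\<Sum>k\<le>b. w k * real k ^ j))" for a
  proof -
    \<comment> \<open>The top power is split off because it cancels against the unshifted
      sum.\<close>
    have binom: "(real (Suc k)) ^ a = (\<Sum>j<a. real (a choose j) * real k ^ j) + real k ^ a" for k
      using binomial_ring[of "real k" 1 a]
      by (simp add: lessThan_Suc_atMost[symmetric] add.commute)
    have "(\<Sum>k\<le>Suc b. w' k * real k ^ a) =
        (\<Sum>k\<le>Suc b. (case k of 0 \<Rightarrow> 0 | Suc j \<Rightarrow> w j) * real k ^ a)
        - (\<Sum>k\<le>Suc b. (if k \<le> b then w k else 0) * real k ^ a)"
      unfolding sum_subtractf[symmetric] by (simp only: w'_def left_diff_distrib)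
    also have "\<dots> = (\<Sum>k\<le>b. w k * real (Suc k) ^ a) - (\<Sum>k\<le>b. w k * real k ^ a)"
      by (subst sum.atMost_Suc_shift) simp
    also have "\<dots> = (\<Sum>k\<le>b. w k * (\<Sum>j<a. real (a choose j) * real k ^ j))"
      unfolding sum_subtractf[symmetric] binom by (simp add: algebra_simps)
    also have "\<dots> = (\<Sum>j<a. real (a choose j) * (\<Sum>k\<le>b. w k * real k ^ j))"
      unfolding sum_distrib_left by (subst sum.swap) (simp add: mult_ac)
    finally show ?thesis .
  qed
  note w'_sum = this
  show ?case
  proof (intro exI[of _ w'] conjI allI impI)
    show "(\<Sum>k\<le>Suc b. w' k * real k ^ a) = 0" if "a < Suc b" for a
      unfolding w'_sum using that by (intro sum.neutral) (auto simp: w)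
    \<comment> \<open>Only the term \<open>j = b\<close> survives, with the nonzero factor
      \<open>Suc b choose b\<close>.\<close>
    show "(\<Sum>k\<le>Suc b. w' k * real k ^ Suc b) \<noteq> 0"
      unfolding w'_sum using w by simp
  qed
qed

text \<open>The tensor product of the one-variable weights on an integer grid: its sum against a
  monomial factors over the coordinates, so a single coordinate with too small an exponent makes it
  vanish.\<close>

lemma mixed_difference:
  fixes \<beta> :: "'n::finite \<Rightarrow> nat"
  obtains P :: "(real ^ 'n) set" and w where "finite P"
    "(\<Sum>x\<in>P. w x * monomial \<beta> x) \<noteq> 0"
    "\<And>\<alpha> i. \<alpha> i < \<beta> i \<Longrightarrow> (\<Sum>x\<in>P. w x * monomial \<alpha> x) = 0"
proof -
  obtain u :: "nat \<Rightarrow> nat \<Rightarrow> real" where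
    u: "\<And>b a. a < b \<Longrightarrow> (\<Sum>k\<le>b. u b k * real k ^ a) = 0" "\<And>b. (\<Sum>k\<le>b. u b k * real k ^ b) \<noteq> 0"
    using finite_difference_weights by metis
  define G where "G = PiE UNIV (\<lambda>i. {..\<beta> i})"
  define pt :: "('n \<Rightarrow> nat) \<Rightarrow> real ^ 'n" where "pt \<gamma> = (\<chi> i. real (\<gamma> i))" for \<gamma>
  \<comment> \<open>The weights are indexed by points rather than multi-indices; on the grid,
    \<open>nat\<close> of the floor recovers the index.\<close>
  define w where "w x = (\<Prod>i\<in>UNIV. u (\<beta> i) (nat \<lfloor>x $ i\<rfloor>))" for x :: "real ^ 'n"
  have inj: "inj_on pt G"
    by (auto simp: inj_on_def pt_def vec_eq_iff fun_eq_iff)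
  have eq: "(\<Sum>x\<in>pt ` G. w x * monomial \<alpha> x) =
      (\<Prod>i\<in>UNIV. \<Sum>k\<le>\<beta> i. u (\<beta> i) k * real k ^ \<alpha> i)" for \<alpha>
  proof -
    have "(\<Sum>x\<in>pt ` G. w x * monomial \<alpha> x) =
        (\<Sum>\<gamma>\<in>G. \<Prod>i\<in>UNIV. u (\<beta> i) (\<gamma> i) * real (\<gamma> i) ^ \<alpha> i)"
      unfolding sum.reindex[OF inj] by (simp add: w_def monomial_def pt_def prod.distrib)
    also have "\<dots> = (\<Prod>i\<in>UNIV. \<Sum>k\<le>\<beta> i. u (\<beta> i) k * real k ^ \<alpha> i)"
      unfolding G_def by (rule prod_sum_PiE[symmetric]) auto
    finally show ?thesis .
  qed
  show thesis
  proof (rule that[of "pt ` G" w])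
    show "finite (pt ` G)" by (auto simp: G_def intro!: finite_PiE)
    show "(\<Sum>x\<in>pt ` G. w x * monomial \<beta> x) \<noteq> 0" unfolding eq using u(2) by simp
    show "(\<Sum>x\<in>pt ` G. w x * monomial \<alpha> x) = 0" if "\<alpha> i < \<beta> i" for \<alpha> i
      unfolding eq using u(1)[OF that] by (auto intro!: bexI[of _ i])
  qed
qed

section \<open>Passing to the pointwise limit\<close>

theorem theorem7:
  fixes V :: "(real ^ 'n \<Rightarrow> real) set"
    and p :: "nat \<Rightarrow> real ^ 'n \<Rightarrow> real"
    and q :: "real ^ 'n \<Rightarrow> real"
  assumes "V \<subseteq> {f. real_polynomial_function f}"
    and "real_fun.subspace V"
    and "TDI V"
    and "\<And>k. p k \<in> V"
    and "\<And>x. (\<lambda>k. p k x) \<longlonglongrightarrow> q x"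
    and "real_polynomial_function q"
  shows "q \<in> V"
proof -
  obtain S c where S: "finite S" "\<And>\<alpha>. \<alpha> \<in> S \<Longrightarrow> c \<alpha> \<noteq> 0"
    and q: "q = (\<lambda>x. \<Sum>\<alpha>\<in>S. c \<alpha> * monomial \<alpha> x)"
    using monomial_expansion[OF assms(6)] by blast
  define B where "B = {\<alpha>\<in>S. monomial \<alpha> \<notin> V}"
  have "B = {}"
  proof (rule ccontr)
    define deg :: "('n \<Rightarrow> nat) \<Rightarrow> nat" where "deg \<alpha> = (\<Sum>i\<in>UNIV. \<alpha> i)" for \<alpha>
    assume "B \<noteq> {}"
    moreover have "finite B" using S(1) by (simp add: B_def)
    ultimately obtain \<beta> where \<beta>: "\<beta> \<in> B" and max: "\<And>\<alpha>. \<alpha> \<in> B \<Longrightarrow> deg \<alpha> \<le> deg \<beta>"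
      using obtains_MAX[of B deg] by (metis Max_ge finite_imageI imageI)
    obtain P :: "(real ^ 'n) set" and w where P: "finite P"
      and nz: "(\<Sum>x\<in>P. w x * monomial \<beta> x) \<noteq> 0"
      and z: "\<And>\<alpha> i. \<alpha> i < \<beta> i \<Longrightarrow> (\<Sum>x\<in>P. w x * monomial \<alpha> x) = 0"
      using mixed_difference[of \<beta>] by blast
    define L where "L f = (\<Sum>x\<in>P. w x * f x)" for f
    have L_sum: "L (\<lambda>x. \<Sum>\<alpha>\<in>T. a \<alpha> * monomial \<alpha> x) = (\<Sum>\<alpha>\<in>T. a \<alpha> * L (monomial \<alpha>))" for T a
      unfolding L_def sum_distrib_left by (subst sum.swap) (simp add: mult_ac)
    have L_monomial: "L (monomial \<alpha>) = 0" if "monomial \<alpha> \<in> V" for \<alpha>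
    proof -
      \<comment> \<open>Otherwise \<beta> would lie below \<alpha> in every coordinate, and
        \<open>monomial \<beta>\<close> would be in \<open>V\<close> by down-closure.\<close>
      have "\<exists>i. \<alpha> i < \<beta> i"
        using TDI_monomial_mono[OF assms(2,3) that, of \<beta>] \<beta>
        by (fastforce simp: B_def simp flip: not_less)
      then show ?thesis using z by (auto simp: L_def)
    qed
    have L_V: "L f = 0" if f: "f \<in> V" for f
    proof -
      obtain T a where T: "finite T" "\<And>\<alpha>. \<alpha> \<in> T \<Longrightarrow> a \<alpha> \<noteq> 0"
        "f = (\<lambda>x. \<Sum>\<alpha>\<in>T. a \<alpha> * monomial \<alpha> x)"
        using monomial_expansion[of f] f assms(1) by blast
      have "monomial \<alpha> \<in> V" if "\<alpha> \<in> T" for \<alpha>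
        using dilation_invariant_monomial[of V T \<alpha> a] assms(2,3) f T that by (auto simp: TDI_def)
      then show ?thesis unfolding T(3) L_sum by (simp add: L_monomial)
    qed
    have "(\<lambda>k. L (p k)) \<longlonglongrightarrow> L q"
      unfolding L_def by (intro tendsto_intros assms(5))
    then have "L q = 0"
      using L_V assms(4) by (simp add: LIMSEQ_const_iff)
    moreover have "L q = c \<beta> * L (monomial \<beta>)"
    proof -
      \<comment> \<open>Exponents in \<open>B\<close> cannot dominate \<beta> without having larger
        degree; the remaining exponents have their monomial in \<open>V\<close>, where
        \<open>L\<close> vanishes.\<close>
      have "L (monomial \<alpha>) = 0" if \<alpha>: "\<alpha> \<in> S" "\<alpha> \<noteq> \<beta>" for \<alpha>
      proof (cases "\<alpha> \<in> B")
        case True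
        have "\<exists>i. \<alpha> i < \<beta> i"
        proof (rule ccontr)
          assume "\<not> (\<exists>i. \<alpha> i < \<beta> i)"
          then have le: "\<And>i. \<beta> i \<le> \<alpha> i" by (simp add: not_less)
          moreover obtain j where "\<alpha> j \<noteq> \<beta> j" using \<alpha>(2) by auto
          ultimately have "\<beta> j < \<alpha> j" by (metis order_less_le)
          with le have "deg \<beta> < deg \<alpha>"
            unfolding deg_def by (intro sum_strict_mono_ex1) auto
          with max[OF True] show False by simp
        qed
        then show ?thesis using z by (auto simp: L_def)
      next
        case False
        with \<alpha> show ?thesis by (simp add: B_def L_monomial)
      qed
      then have "(\<Sum>\<alpha>\<in>S. c \<alpha> * L (monomial \<alpha>)) = (\<Sum>\<alpha>\<in>{\<beta>}. c \<alpha> * L (monomial \<alpha>))"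
        using S(1) \<beta> by (intro sum.mono_neutral_right) (auto simp: B_def)
      then show ?thesis unfolding q L_sum by simp
    qed
    ultimately show False
      using S(2) \<beta> nz by (auto simp: B_def L_def)
  qed
  then have "monomial \<alpha> \<in> V" if "\<alpha> \<in> S" for \<alpha>
    using that by (auto simp: B_def)
  then show ?thesis
    unfolding q by (intro real_fun_subspace_combination assms(2))
qed

end
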